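(* Let $n$ be a positive integer. The set of nonzero eigenvalues of the operator $U_n$ acting on $\mathcal{R}$ is $$\left\{ e^{\frac{2\pi i m}{\mathrm{ord}_L(n)}}\, n^{\kappa-1}\ \middle|\ m\in\mathbb{Z},\ \kappa \text{ and } L \text{ positive integers},\ \gcd(n,L)=1\right\}.$$
   Context: $\mathcal{R}$ is the complex vector space of rational functions $p(x)/q(x)$, $p,q\in\mathbb{C}[x]$, that are analytic at the origin; each is identified with its Taylor series $\sum_{k\ge 0}a(k)x^k$ at $0$. For a positive integer $n$, $U_n:\mathcal{R}\to\mathcal{R}$ is the linear operator $U_n\left(\sum_{k\ge 0}a(k)x^k\right)=\sum_{k\ge 0}a(nk)x^k$. $\mathrm{ord}_L(n)$ denotes the multiplicative order of $n$ modulo $L$ (equal to $1$ if $L=1$). A number $\lambda\in\mathbb{C}$ is an eigenvalue if there is a nonzero $f\in\mathcal{R}$ with $U_n f=\lambda f$. *)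

theory Defs
  imports
    "HOL-Number_Theory.Pocklington"
    "HOL-Analysis.Analysis"
    "HOL-Computational_Algebra.Computational_Algebra"
begin

(* A rational function is identified with its Taylor series at the origin.
   has_fps_expansion also demands agreement at 0 itself. Since x / 0 = 0, a fraction p / q with a
   removable singularity at 0 need not have an expansion, but the same rational function
   in lowest terms does; rat_series_iff shows that nothing is lost or gained. *)
definition rat_series :: "complex fps set" where
  "rat_series = {F. \<exists>p q :: complex poly. q \<noteq> 0 \<and> (\<lambda>z. poly p z / poly q z) has_fps_expansion F}"

definition U_op :: "nat \<Rightarrow> complex fps \<Rightarrow> complex fps" where
  "U_op n F = Abs_fps (\<lambda>k. fps_nth F (n * k))"

(* Multiplication by fps_const c is multiplication by the scalar c. *)
definition U_eigenvalue :: "nat \<Rightarrow> complex \<Rightarrow> bool" where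
  "U_eigenvalue n c \<longleftrightarrow> (\<exists>F \<in> rat_series. F \<noteq> 0 \<and> U_op n F = fps_const c * F)"


lemma has_fps_expansion_poly: "poly p has_fps_expansion fps_of_poly (p :: complex poly)"
proof (rule has_fps_expansionI, rule always_eventually, rule allI)
  fix z :: complex
  have "(\<lambda>k. coeff p k * z ^ k) sums (\<Sum>k\<le>degree p. coeff p k * z ^ k)"
    by (rule sums_finite) (auto simp: coeff_eq_0)
  then show "(\<lambda>k. fps_nth (fps_of_poly p) k * z ^ k) sums poly p z"
    by (simp add: poly_altdef)
qed

lemma rat_seriesI:
  assumes q: "coeff q 0 \<noteq> 0" and F: "F * fps_of_poly q = fps_of_poly p"
  shows "F \<in> rat_series"
proof -
  have nz: "fps_of_poly q \<noteq> 0" using q by (auto simp: fps_eq_iff)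
  have "(\<lambda>z. poly p z / poly q z) has_fps_expansion fps_of_poly p / fps_of_poly q"
    using q by (intro has_fps_expansion_divide' has_fps_expansion_poly) auto
  moreover have "fps_of_poly p / fps_of_poly q = F"
    using nz by (simp flip: F)
  moreover have "q \<noteq> 0" using q by auto
  ultimately show ?thesis by (auto simp: rat_series_def)
qed

lemma rat_seriesE:
  assumes "F \<in> rat_series"
  obtains p q where "coeff q 0 \<noteq> 0" "F * fps_of_poly q = fps_of_poly p"
proof -
  obtain p q where q0: "q \<noteq> 0" and F: "(\<lambda>z. poly p z / poly q z) has_fps_expansion F"
    using assms by (auto simp: rat_series_def)
  let ?h = "\<lambda>z. poly p z / poly q z * poly q z"
  have h: "?h has_fps_expansion F * fps_of_poly q"
    by (intro has_fps_expansion_mult F has_fps_expansion_poly)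
  have "open (- ({z. poly q z = 0} - {0}))"
    using poly_roots_finite[OF q0] by (intro open_Compl finite_imp_closed) auto
  then have "eventually (\<lambda>z. z \<in> - ({z. poly q z = 0} - {0})) (nhds 0)"
    by (rule eventually_nhds_in_open) auto
  then have ev: "eventually (\<lambda>z. z \<noteq> 0 \<longrightarrow> ?h z = poly p z) (nhds 0)"
    by eventually_elim auto
  have "isCont ?h 0"
    using has_fps_expansion_imp_continuous[OF h, of UNIV] by simp
  then have "?h \<midarrow>0\<rightarrow> ?h 0" by (simp add: isCont_def)
  moreover have "eventually (\<lambda>z. ?h z = poly p z) (at 0)"
    using ev by (simp add: eventually_at_filter)
  ultimately have "poly p \<midarrow>0\<rightarrow> ?h 0"
    using Lim_transform_eventually by blast
  moreover have "poly p \<midarrow>0\<rightarrow> poly p 0"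
    by (intro tendsto_intros)
  ultimately have "?h 0 = poly p 0"
    using LIM_unique by blast
  with ev have "eventually (\<lambda>z. poly p z = ?h z) (nhds 0)"
    by (auto elim!: eventually_mono)
  then have "?h has_fps_expansion fps_of_poly p"
    using has_fps_expansion_poly[of p] unfolding has_fps_expansion_def
    by (auto elim: eventually_elim2)
  with h have *: "F * fps_of_poly q = fps_of_poly p"
    by (intro fps_ext) (simp only: fps_nth_fps_expansion)
  define m where "m = order 0 q"
  obtain q' where q': "q = [:0, 1:] ^ m * q'" "\<not> [:0, 1:] dvd q'"
    using order_decomp[OF q0, of 0] by (auto simp: m_def)
  have q'0: "coeff q' 0 \<noteq> 0"
    using q'(2) poly_eq_0_iff_dvd[of q' 0] by (simp add: poly_0_coeff_0)
  have **: "fps_X ^ m * (F * fps_of_poly q') = fps_of_poly p"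
    using * by (simp add: q' fps_of_poly_mult fps_of_poly_power mult_ac)
  have "F * fps_of_poly q' = fps_shift m (fps_of_poly p)"
    unfolding **[symmetric] by (intro fps_ext) (simp only: fps_shift_nth fps_X_power_mult_nth, simp)
  then have "F * fps_of_poly q' = fps_of_poly (poly_shift m p)" by simp
  with q'0 show ?thesis by (rule that)
qed

lemma rat_series_iff:
  "F \<in> rat_series \<longleftrightarrow> (\<exists>p q. coeff q 0 \<noteq> 0 \<and> F * fps_of_poly q = fps_of_poly p)"
  by (blast intro: rat_seriesI elim: rat_seriesE)

lemma rat_series_0: "0 \<in> rat_series"
  by (rule rat_seriesI[of 1 _ 0]) auto

lemma rat_series_add:
  assumes "F \<in> rat_series" "G \<in> rat_series"
  shows "F + G \<in> rat_series"
proof -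
  obtain p q where F: "coeff q 0 \<noteq> 0" "F * fps_of_poly q = fps_of_poly p"
    using assms(1) by (rule rat_seriesE)
  obtain r s where G: "coeff s 0 \<noteq> 0" "G * fps_of_poly s = fps_of_poly r"
    using assms(2) by (rule rat_seriesE)
  show ?thesis
  proof (rule rat_seriesI)
    show "coeff (q * s) 0 \<noteq> 0" using F G by (simp add: coeff_mult)
    show "(F + G) * fps_of_poly (q * s) = fps_of_poly (p * s + r * q)"
      by (simp add: fps_of_poly_mult fps_of_poly_add algebra_simps flip: F G)
  qed
qed

lemma rat_series_scale:
  assumes "F \<in> rat_series"
  shows "fps_const c * F \<in> rat_series"
proof -
  obtain p q where F: "coeff q 0 \<noteq> 0" "F * fps_of_poly q = fps_of_poly p"
    using assms by (rule rat_seriesE)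
  then show ?thesis
    by (intro rat_seriesI[of q _ "smult c p"]) (simp_all add: fps_of_poly_smult mult.assoc)
qed

lemma U_op_add: "U_op n (F + G) = U_op n F + U_op n G"
  by (simp add: U_op_def fps_eq_iff)

lemma U_op_scale: "U_op n (fps_const c * F) = fps_const c * U_op n F"
  by (simp add: U_op_def fps_eq_iff)

lemma U_op_mult_compose:
  assumes "n > 0"
  shows "U_op n (F * fps_compose G (fps_X ^ n)) = U_op n F * G"
proof (rule fps_ext)
  fix k
  have "fps_nth (U_op n (F * fps_compose G (fps_X ^ n))) k =
          (\<Sum>i=0..n*k. fps_nth (fps_compose G (fps_X ^ n)) i * fps_nth F (n * k - i))"
    by (simp add: U_op_def fps_mult_nth mult.commute[of F])
  also have "\<dots> = (\<Sum>i\<in>(*) n ` {0..k}. fps_nth (fps_compose G (fps_X ^ n)) i * fps_nth F (n * k - i))"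
    using assms by (intro sum.mono_neutral_right) (auto simp: fps_nth_compose_X_power)
  also have "\<dots> = (\<Sum>i=0..k. fps_nth G i * fps_nth F (n * (k - i)))"
    using assms by (subst sum.reindex)
      (auto simp: inj_on_def fps_nth_compose_X_power diff_mult_distrib2)
  also have "\<dots> = fps_nth (U_op n F * G) k"
    by (simp add: U_op_def fps_mult_nth mult.commute[of _ G])
  finally show "fps_nth (U_op n (F * fps_compose G (fps_X ^ n))) k = fps_nth (U_op n F * G) k" .
qed

lemma poly_multiple_in_X_power:
  fixes q :: "complex poly"
  assumes "n > 0" "coeff q 0 \<noteq> 0"
  shows "\<exists>s. coeff s 0 \<noteq> 0 \<and> q dvd pcompose s (monom 1 n)"
  using assms(2)
proof (induction "degree q" arbitrary: q)
  case 0
  then obtain c where "q = [:c:]" "c \<noteq> 0"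
    by (metis coeff_pCons_0 degree_0_id)
  then have "1 = q * [:1 / c:]" by (simp add: one_pCons)
  then have "q dvd 1" by (rule dvdI)
  then have "q dvd pcompose 1 (monom 1 n)" by (rule dvd_trans) (rule one_dvd)
  then show ?case by (intro exI[of _ 1]) simp
next
  case (Suc d)
  then obtain a where a: "poly q a = 0"
    using fundamental_theorem_of_algebra[of q] constant_degree[of q] by auto
  then obtain r where r: "q = [:-a, 1:] * r"
    by (auto simp: poly_eq_0_iff_dvd)
  have a0: "a \<noteq> 0" and r0: "coeff r 0 \<noteq> 0"
    using Suc.prems by (auto simp: r coeff_mult)
  have "r \<noteq> 0" using r0 by auto
  then have "degree q = Suc (degree r)"
    by (simp add: r degree_mult_eq del: mult_pCons_left)
  with Suc r0 obtain s where s: "coeff s 0 \<noteq> 0" "r dvd pcompose s (monom 1 n)"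
    by (metis Suc_inject)
  have "[:-a, 1:] dvd pcompose [:-(a ^ n), 1:] (monom 1 n)"
    by (simp add: pcompose_pCons poly_monom flip: poly_eq_0_iff_dvd)
  then have "q dvd pcompose ([:-(a ^ n), 1:] * s) (monom 1 n)"
    unfolding r pcompose_mult using s by (intro mult_dvd_mono)
  moreover have "coeff ([:-(a ^ n), 1:] * s) 0 \<noteq> 0"
    using s a0 by (simp add: coeff_mult)
  ultimately show ?case by blast
qed

lemma U_op_rat_series:
  assumes "n > 0" "F \<in> rat_series"
  shows "U_op n F \<in> rat_series"
proof -
  obtain p q where F: "coeff q 0 \<noteq> 0" "F * fps_of_poly q = fps_of_poly p"
    using assms(2) by (rule rat_seriesE)
  obtain s where s: "coeff s 0 \<noteq> 0" "q dvd pcompose s (monom 1 n)"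
    using poly_multiple_in_X_power[OF assms(1) F(1)] by blast
  then obtain r where r: "pcompose s (monom 1 n) = q * r" by (elim dvdE)
  have "fps_compose (fps_of_poly s) (fps_X ^ n) = fps_of_poly q * fps_of_poly r"
    using assms(1) 
    by (simp add: fps_of_poly_pcompose fps_of_poly_monom' flip: r fps_of_poly_mult)
  then have "F * fps_compose (fps_of_poly s) (fps_X ^ n) = fps_of_poly (p * r)"
    using F(2) by (simp add: fps_of_poly_mult flip: mult.assoc)
  then have *: "U_op n F * fps_of_poly s = U_op n (fps_of_poly (p * r))"
    using U_op_mult_compose[OF assms(1), of F "fps_of_poly s"] by simp
  define t where "t = Poly (map (\<lambda>k. coeff (p * r) (n * k)) [0..<Suc (degree (p * r))])"
  have "U_op n (fps_of_poly (p * r)) = fps_of_poly t"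
  proof (rule fps_ext)
    fix k
    have "coeff (p * r) (n * k) = 0" if "k > degree (p * r)"
    proof (rule coeff_eq_0)
      have "1 * k \<le> n * k" using assms(1) by (intro mult_right_mono) auto
      with that show "degree (p * r) < n * k" by linarith
    qed
    then show "fps_nth (U_op n (fps_of_poly (p * r))) k = fps_nth (fps_of_poly t) k"
      by (auto simp: U_op_def t_def nth_default_def simp del: upt_Suc)
  qed
  with * s(1) show ?thesis by (intro rat_seriesI[of s]) auto
qed

end

theory Submission
  imports Defs
begin

text \<open>
  The case \<open>n = 1\<close> is trivial, so let \<open>n > 1\<close>. The operator sends the poles of a rational function to
  \<open>n\<close>-th powers of poles. If \<open>F\<close> is an eigenfunction with eigenvalue \<open>c \<noteq> 0\<close>, no pole may be lost, so
  taking \<open>n\<close>-th powers permutes the finitely many poles; some iterate is the identity on them, and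
  therefore all poles satisfy \<open>a\<^sup>L = 1\<close> with \<open>L = n\<^sup>e - 1\<close> (\<open>eigenfunction_denominator\<close>). It
  follows that on each residue class modulo \<open>L\<close> the coefficients of \<open>F\<close> are eventually given by a
  polynomial in the index (\<open>coeffs_eventually_poly_on_residue_class\<close>).

  Now start from an index \<open>k > 0\<close> with a nonzero coefficient. All indices \<open>n\<^sup>e\<^sup>t k\<close> are
  congruent to \<open>k\<close> modulo \<open>L\<close>, and the eigenvalue equation multiplies the coefficient by \<open>c\<^sup>e\<close> at
  each step. Hence the polynomial \<open>Q\<close> for this class satisfies \<open>Q(n\<^sup>e x) = c\<^sup>e Q(x)\<close> at
  infinitely many points, thus identically, and comparing leading coefficients gives
  \<open>c\<^sup>e = (n\<^sup>e)\<^sup>d\<close> for \<open>d = deg Q\<close>: the quotient of \<open>c\<close> by \<open>n\<^sup>d\<close> is an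
  \<open>e\<close>-th root of unity. As \<open>n\<close> has order exactly \<open>e\<close> modulo \<open>n\<^sup>e - 1\<close>, this is a value of the
  required form. If only the constant coefficient is nonzero, then \<open>c = 1\<close>.

  Conversely, for \<open>\<omega>\<close> with \<open>\<omega>\<^sup>d = 1\<close>, where \<open>d\<close> is the order of \<open>n\<close> modulo \<open>L\<close>, the function
  that is \<open>\<omega>\<^sup>j\<close> on the class of \<open>n\<^sup>j\<close> modulo \<open>L\<close> and zero on all other classes is well defined and
  is multiplied by \<open>\<omega>\<close> under \<open>k \<mapsto> n k\<close>. Its product with \<open>k\<^sup>i\<close> is the coefficient sequence of a
  rational eigenfunction with eigenvalue \<open>\<omega> n\<^sup>i\<close>.
\<close>

section \<open>Poles of an eigenfunction\<close>

lemma fps_eventually_zero_is_poly: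
  fixes F :: "'a::comm_ring_1 fps"
  assumes "\<And>k. k > d \<Longrightarrow> fps_nth F k = 0"
  obtains t where "F = fps_of_poly t"
proof
  show "F = fps_of_poly (Poly (map (fps_nth F) [0..<Suc d]))"
    using assms by (auto simp: fps_eq_iff nth_default_def simp del: upt_Suc)
qed

lemma U_op_fps_of_poly:
  assumes "n > 0"
  obtains t where "U_op n (fps_of_poly p) = fps_of_poly t"
proof (rule fps_eventually_zero_is_poly[of "degree p" "U_op n (fps_of_poly p)"])
  fix k assume "degree p < k"
  moreover have "k \<le> n * k"
    using assms by simp
  ultimately have "degree p < n * k" by linarith
  then show "fps_nth (U_op n (fps_of_poly p)) k = 0"
    by (simp add: U_op_def coeff_eq_0)
qed

text \<open>
  One can take \<open>s = \<Prod> (x - a\<^sup>n)\<close> over the roots \<open>a\<close> of \<open>q\<close> with multiplicity, since \<open>x - a\<close> divides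
  \<open>x\<^sup>n - a\<^sup>n\<close>. If \<open>q\<close> is a denominator of \<open>F\<close>, then \<open>s\<close> is one of \<open>U_op n F\<close>, so the statement
  about roots is what bounds the poles of \<open>U_op n F\<close>.
\<close>

lemma poly_multiple_in_X_power_roots:
  fixes q :: "complex poly"
  assumes "q \<noteq> 0"
  shows "\<exists>s. q dvd pcompose s (monom 1 n) \<and> (\<forall>z. poly s z = 0 \<longrightarrow> (\<exists>a. poly q a = 0 \<and> z = a ^ n))"
  using assms
proof (induction "degree q" arbitrary: q)
  case 0
  then obtain c where "q = [:c:]" "c \<noteq> 0"
    by (metis degree_0_id of_nat_0 pCons_0_0)
  then have "q dvd pcompose 1 (monom 1 n)"
    by (simp add: pcompose_1 is_unit_const_poly_iff dvd_field_iff)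
  then show ?case by (intro exI[of _ 1]) simp
next
  case (Suc d)
  then obtain a where a: "poly q a = 0"
    using fundamental_theorem_of_algebra[of q] constant_degree[of q] by auto
  then obtain r where r: "q = [:-a, 1:] * r"
    by (auto simp: poly_eq_0_iff_dvd)
  have "r \<noteq> 0" using Suc.prems r by auto
  then have "degree q = Suc (degree r)"
    by (simp add: r degree_mult_eq del: mult_pCons_left)
  with Suc.hyps \<open>r \<noteq> 0\<close> obtain s where s: "r dvd pcompose s (monom 1 n)"
      "\<And>z. poly s z = 0 \<Longrightarrow> \<exists>a. poly r a = 0 \<and> z = a ^ n"
    by (metis Suc_inject)
  have "[:-a, 1:] dvd pcompose [:-(a ^ n), 1:] (monom 1 n)"
    by (simp add: pcompose_pCons poly_monom flip: poly_eq_0_iff_dvd)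
  then have "q dvd pcompose ([:-(a ^ n), 1:] * s) (monom 1 n)"
    unfolding r pcompose_mult using s by (intro mult_dvd_mono)
  moreover have "\<exists>b. poly q b = 0 \<and> z = b ^ n" if "poly ([:-(a ^ n), 1:] * s) z = 0" for z
  proof -
    from that have "z = a ^ n \<or> poly s z = 0"
      by (simp del: mult_pCons_left)
    then show ?thesis
      using a s(2)[of z] by (auto simp: r simp del: mult_pCons_left)
  qed
  ultimately show ?case by blast
qed

text \<open>
  The polynomials \<open>q\<close> for which \<open>F q\<close> is a polynomial form an ideal, and \<open>q\<close> is its generator. Its
  roots are the poles of \<open>F\<close>.
\<close>

lemma minimal_denominator:
  assumes "F \<in> rat_series"
  obtains q where "coeff q 0 \<noteq> 0"
    and "\<exists>p. F * fps_of_poly q = fps_of_poly p"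
    and "\<And>s t. F * fps_of_poly s = fps_of_poly t \<Longrightarrow> q dvd s"
proof -
  define D where "D = {q. \<exists>p. F * fps_of_poly q = fps_of_poly p}"
  obtain q0 where q0: "coeff q0 0 \<noteq> 0" "q0 \<in> D"
    using assms by (auto simp: D_def elim: rat_seriesE)
  define q where "q = arg_min degree (\<lambda>q. q \<in> D \<and> q \<noteq> 0)"
  have "q0 \<in> D \<and> q0 \<noteq> 0" using q0 by auto
  from arg_min_nat_lemma[of "\<lambda>q. q \<in> D \<and> q \<noteq> 0", OF this, of degree]
  have q: "q \<in> D" "q \<noteq> 0" and qmin: "\<And>r. r \<in> D \<Longrightarrow> r \<noteq> 0 \<Longrightarrow> degree q \<le> degree r"
    by (auto simp: q_def)
  obtain p where p: "F * fps_of_poly q = fps_of_poly p"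
    using q(1) by (auto simp: D_def)
  have dvd: "q dvd s" if "F * fps_of_poly s = fps_of_poly t" for s t
  proof -
    have "F * fps_of_poly (s mod q) = fps_of_poly (t - (s div q) * p)"
      by (simp add: minus_div_mult_eq_mod[symmetric] fps_of_poly_diff fps_of_poly_mult
          algebra_simps flip: p that)
    then have "s mod q \<in> D" by (auto simp: D_def)
    then have "s mod q = 0"
      using qmin[of "s mod q"] degree_mod_less'[OF q(2), of s] by fastforce
    then show ?thesis by (simp add: mod_eq_0_iff_dvd)
  qed
  obtain u where "q0 = q * u"
    using q0(2) dvd unfolding D_def by (blast elim: dvdE)
  then have "coeff q 0 \<noteq> 0"
    using q0(1) by (auto simp: coeff_mult)
  then show ?thesis
    using that[of q] p dvd by blast
qed

text \<open>
  A surjective self-map of a finite set is a permutation, hence has finite order \<open>e\<close>; and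
  \<open>a\<^sup>N = a\<close> with \<open>N = n\<^sup>e\<close> makes the nonzero number \<open>a\<close> a root of unity when \<open>n > 1\<close> (for \<open>n = 1\<close> the exponent is \<open>0\<close>). One exponent \<open>e\<close> has to
  serve all of \<open>R\<close>, so the pigeonhole argument is applied to the iterates as maps on \<open>R\<close>, not to the
  orbits of single points.
\<close>

lemma power_surj_imp_roots_of_unity:
  fixes R :: "complex set"
  assumes "finite R" "0 \<notin> R" "n > 0" "R \<subseteq> (\<lambda>a. a ^ n) ` R"
  obtains e where "e > 0" "\<And>a. a \<in> R \<Longrightarrow> a ^ (n ^ e - 1) = 1"
proof -
  define f where "f = (\<lambda>a::complex. a ^ n)"
  have fR: "f ` R = R"
    using assms card_image_le[of R f] card_seteq[of "f ` R" R] unfolding f_def by auto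
  have fjR: "(\<lambda>a. a ^ (n ^ j)) ` R = R" for j
  proof (induction j)
    case (Suc j)
    have "(\<lambda>a. a ^ (n ^ Suc j)) ` R = f ` ((\<lambda>a. a ^ (n ^ j)) ` R)"
      by (simp add: f_def image_image mult.commute flip: power_mult)
    with Suc fR show ?case by simp
  qed simp
  define g where "g = (\<lambda>j. restrict (\<lambda>a::complex. a ^ (n ^ j)) R)"
  have "range g \<subseteq> R \<rightarrow>\<^sub>E R"
    using fjR by (fastforce simp: g_def)
  moreover have "finite (R \<rightarrow>\<^sub>E R)"
    using assms(1) by (intro finite_PiE)
  ultimately have "\<not> inj g"
    using finite_subset finite_imageD[of g UNIV] by auto
  then obtain i j where ij: "i < j" "g i = g j"
    unfolding inj_def by (metis linorder_neqE_nat)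
  show ?thesis
  proof (rule that[of "j - i"])
    fix b assume "b \<in> R"
    then obtain a where a: "a \<in> R" "b = a ^ (n ^ i)"
      using fjR[of i] by blast
    have "b ^ (n ^ (j - i)) = a ^ (n ^ j)"
      using ij(1) by (simp add: a(2) flip: power_mult power_add)
    also have "\<dots> = b"
      using fun_cong[OF ij(2), of a] a by (simp add: g_def)
    finally have "b ^ (n ^ (j - i) - 1) * b = b"
      using assms(3) by (simp flip: power_Suc2)
    moreover have "b \<noteq> 0" using \<open>b \<in> R\<close> assms(2) by auto
    ultimately show "b ^ (n ^ (j - i) - 1) = 1" by simp
  qed (use ij in auto)
qed

text \<open>
  Since \<open>F\<close> is a nonzero multiple of \<open>U_op n F\<close>, every pole of \<open>F\<close> is an \<open>n\<close>-th power of a pole of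
  \<open>F\<close>. For \<open>n > 1\<close> the poles are thus roots of unity, and the minimal denominator divides a power of
  \<open>1 - x\<^sup>L\<close> with \<open>L = n\<^sup>e - 1\<close>; for \<open>n = 1\<close> that polynomial is zero and nothing is claimed.
\<close>

lemma eigenfunction_denominator:
  assumes n: "n > 0" and F: "F \<in> rat_series" and c: "c \<noteq> 0" and U: "U_op n F = fps_const c * F"
  obtains e K p where "e > 0" "F * fps_of_poly ((1 - monom 1 (n ^ e - 1)) ^ K) = fps_of_poly p"
proof -
  obtain q p where q: "coeff q 0 \<noteq> 0" and p: "F * fps_of_poly q = fps_of_poly p"
    and qmin: "\<And>s t. F * fps_of_poly s = fps_of_poly t \<Longrightarrow> q dvd s"
    using F by (rule minimal_denominator) blast
  have "q \<noteq> 0" using q by auto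
  then obtain s where s: "q dvd pcompose s (monom 1 n)"
      "\<And>z. poly s z = 0 \<Longrightarrow> \<exists>a. poly q a = 0 \<and> z = a ^ n"
    using poly_multiple_in_X_power_roots[of q n] by blast
  obtain r where r: "pcompose s (monom 1 n) = q * r"
    using s(1) by (elim dvdE)
  have "fps_compose (fps_of_poly s) (fps_X ^ n) = fps_of_poly q * fps_of_poly r"
    using n by (simp add: fps_of_poly_pcompose fps_of_poly_monom' flip: r fps_of_poly_mult)
  then have "F * fps_compose (fps_of_poly s) (fps_X ^ n) = fps_of_poly (p * r)"
    using p by (simp add: fps_of_poly_mult flip: mult.assoc)
  moreover obtain t where "U_op n (fps_of_poly (p * r)) = fps_of_poly t"
    using n by (rule U_op_fps_of_poly)
  ultimately have "fps_const c * F * fps_of_poly s = fps_of_poly t"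
    using U_op_mult_compose[OF n, of F "fps_of_poly s"] U by simp
  then have "fps_const (1 / c) * (fps_const c * F * fps_of_poly s) = fps_of_poly (smult (1 / c) t)"
    by (simp add: fps_of_poly_smult)
  then have "F * fps_of_poly s = fps_of_poly (smult (1 / c) t)"
    using c by (simp add: fps_const_mult[symmetric] mult.assoc[symmetric] del: fps_const_mult)
      (simp add: fps_const_mult)
  then have "q dvd s" by (rule qmin)
  then have sub: "{a. poly q a = 0} \<subseteq> (\<lambda>a. a ^ n) ` {a. poly q a = 0}"
    using s(2) by (fastforce simp: dvd_def)
  obtain e where e: "e > 0" "\<And>a. poly q a = 0 \<Longrightarrow> a ^ (n ^ e - 1) = 1"
    using power_surj_imp_roots_of_unity[OF _ _ n sub] poly_roots_finite[OF \<open>q \<noteq> 0\<close>] q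
    by (auto simp: poly_0_coeff_0)
  have "\<forall>x. poly q x = 0 \<longrightarrow> poly (1 - monom 1 (n ^ e - 1)) x = 0"
    using e(2) by (simp add: poly_monom)
  then have "q dvd (1 - monom 1 (n ^ e - 1)) ^ degree q"
    using \<open>q \<noteq> 0\<close> by (simp only: nullstellensatz_univariate) simp
  then obtain u where "(1 - monom 1 (n ^ e - 1)) ^ degree q = q * u" by (elim dvdE)
  then have "F * fps_of_poly ((1 - monom 1 (n ^ e - 1)) ^ degree q) = fps_of_poly (p * u)"
    by (simp add: fps_of_poly_mult mult.assoc flip: p)
  with e(1) show ?thesis by (rule that)
qed

section \<open>Quasi-polynomial coefficients\<close>

lemma pcompose_monom:
  fixes q :: "'a::comm_ring_1 poly"
  shows "pcompose (monom 1 m) q = q ^ m"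
  by (induction m) (simp_all add: monom_Suc pcompose_pCons pcompose_1 monom_0)

text \<open>
  The difference operator with step \<open>h\<close> lowers degrees by exactly one: it takes \<open>x^(d + 1)\<close> to a
  polynomial with leading term \<open>(d + 1) h x^d\<close>. So the top coefficient of \<open>Q\<close> can be removed
  step by step.
\<close>

lemma poly_antidifference:
  fixes Q :: "'a::field_char_0 poly"
  assumes "h \<noteq> 0"
  obtains R where "R - pcompose R [:- h, 1:] = Q"
proof -
  have "\<exists>R. R - pcompose R [:- h, 1:] = Q" if "\<And>i. i \<ge> d \<Longrightarrow> coeff Q i = 0" for d
    using that
  proof (induction d arbitrary: Q)
    case 0
    then have "Q = 0" by (simp add: poly_eq_iff)
    then show ?case by (intro exI[of _ 0]) simp
  next
    case (Suc d)
    define T where "T = monom 1 (Suc d) - pcompose (monom 1 (Suc d)) [:- h, 1:]"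
    have T: "T = monom 1 (Suc d) - [:- h, 1:] ^ Suc d"
      unfolding T_def by (simp only: pcompose_monom)
    have Td: "coeff T d = of_nat (Suc d) * h"
      unfolding T coeff_diff by (subst coeff_linear_poly_power) auto
    have Ti: "coeff T i = 0" if "i > d" for i
    proof (cases "i = Suc d")
      case False
      with that have "degree ([:- h, 1:] ^ Suc d) < i"
        by (simp only: degree_linear_power)
      then have "coeff ([:- h, 1:] ^ Suc d) i = 0" by (rule coeff_eq_0)
      with False show ?thesis unfolding T coeff_diff by simp
    qed (unfold T coeff_diff, subst coeff_linear_poly_power, auto)
    define b where "b = coeff Q d / (of_nat (Suc d) * h)"
    have "coeff (Q - smult b T) i = 0" if "i \<ge> d" for i
    proof (cases "i = d")
      case True
      have "(of_nat (Suc d) :: 'a) \<noteq> 0" by (simp only: of_nat_eq_0_iff)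
      with True assms show ?thesis by (simp add: Td b_def del: of_nat_Suc)
    qed (use that Ti Suc.prems in simp)
    then obtain R where R: "R - pcompose R [:- h, 1:] = Q - smult b T"
      using Suc.IH by blast
    have "(R + smult b (monom 1 (Suc d))) - pcompose (R + smult b (monom 1 (Suc d))) [:- h, 1:] =
        (R - pcompose R [:- h, 1:]) + smult b T"
      by (simp add: pcompose_add pcompose_smult T_def smult_diff_right)
    also have "\<dots> = Q" by (simp add: R)
    finally show ?case by blast
  qed
  from this[of "Suc (degree Q)"] show ?thesis
    using that by (auto simp: coeff_eq_0)
qed

text \<open>
  Multiplication by \<open>1 - x\<^sup>L\<close> takes differences of coefficients along residue classes modulo \<open>L\<close>, so
  each factor is undone by an antidifference, which raises the degree by at most one and adds a constant.
\<close>

lemma coeffs_eventually_poly_on_residue_class: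
  fixes F :: "'a::field_char_0 fps"
  assumes "L > 0" "F * fps_of_poly ((1 - monom 1 L) ^ K) = fps_of_poly p"
  shows "\<exists>Q N0. \<forall>N\<ge>N0. [N = r] (mod L) \<longrightarrow> fps_nth F N = poly Q (of_nat N)"
  using assms(2)
proof (induction K arbitrary: F)
  case 0
  then have "F = fps_of_poly p" by simp
  then show ?case
    by (intro exI[of _ 0] exI[of _ "Suc (degree p)"]) (auto simp: coeff_eq_0)
next
  case (Suc K)
  define G where "G = F * (1 - fps_X ^ L)"
  have "G * fps_of_poly ((1 - monom 1 L) ^ K) = fps_of_poly p"
    using Suc.prems
    by (simp add: G_def fps_of_poly_mult fps_of_poly_diff fps_of_poly_monom' mult.assoc)
  from Suc.IH[OF this] obtain Q N0
    where Q: "\<And>N. N \<ge> N0 \<Longrightarrow> [N = r] (mod L) \<Longrightarrow> fps_nth G N = poly Q (of_nat N)"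
    by blast
  have "(of_nat L :: 'a) \<noteq> 0" using assms(1) by simp
  then obtain R where R: "R - pcompose R [:- of_nat L, 1:] = Q"
    by (rule poly_antidifference)
  \<comment> \<open>A member of the residue class that is at least \<open>N0\<close>, from which the differences are summed.\<close>
  define N1 where "N1 = r + L * N0"
  have N1: "N1 \<ge> N0" "[N1 = r] (mod L)"
    using assms(1) by (simp add: N1_def trans_le_add2) (simp add: N1_def unique_euclidean_semiring_class.cong_def)
  define b where "b = fps_nth F N1 - poly R (of_nat N1)"
  have step: "fps_nth F (N1 + L * t) = poly R (of_nat (N1 + L * t)) + b" for t
  proof (induction t)
    case (Suc t)
    let ?N = "N1 + L * Suc t"
    have "[?N = r] (mod L)"
      using N1(2) by (simp add: unique_euclidean_semiring_class.cong_def mod_add_left_eq del: mult_Suc_right)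
    then have "fps_nth G ?N = poly Q (of_nat ?N)"
      using N1 by (intro Q) auto
    moreover have "fps_nth G ?N = fps_nth F ?N - fps_nth F (N1 + L * t)"
      by (simp add: G_def right_diff_distrib fps_X_power_mult_right_nth)
    ultimately have "fps_nth F ?N = poly Q (of_nat ?N) + fps_nth F (N1 + L * t)"
      by (simp only: diff_eq_eq)
    also have "poly Q (of_nat ?N) = poly R (of_nat ?N) - poly R (of_nat (N1 + L * t))"
      by (simp add: R[symmetric] poly_pcompose algebra_simps)
    finally show ?case
      by (simp only: Suc add.assoc[symmetric] diff_add_cancel)
  qed (simp add: b_def)
  have "fps_nth F N = poly (R + [:b:]) (of_nat N)" if N: "N \<ge> N1" "[N = r] (mod L)" for N
  proof -
    have "[N = N1] (mod L)" using N N1 by (metis cong_sym cong_trans)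
    then have "L dvd N - N1"
      using N(1) by (simp add: cong_altdef_nat)
    then obtain t where "N = N1 + L * t"
      using N(1) by (metis dvd_def le_add_diff_inverse)
    then show ?thesis using step[of t] by simp
  qed
  then show ?case by blast
qed

section \<open>Every eigenvalue is a root of unity times a power\<close>

lemma poly_dilation_eigenvalue:
  fixes Q :: "'a::field_char_0 poly"
  assumes "Q \<noteq> 0" "N \<noteq> 0" "infinite {x. poly Q (N * x) = C * poly Q x}"
  shows "C = N ^ degree Q"
proof -
  have "{x. poly Q (N * x) = C * poly Q x} = {x. poly (pcompose Q [:0, N:] - smult C Q) x = 0}"
    by (simp add: poly_pcompose mult.commute)
  then have "pcompose Q [:0, N:] - smult C Q = 0"
    using assms(3) poly_roots_finite by metis
  then have "coeff (pcompose Q [:0, N:]) (degree Q) = C * lead_coeff Q"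
    by simp
  moreover have "coeff (pcompose Q [:0, N:]) (degree Q) = lead_coeff Q * N ^ degree Q"
    using lead_coeff_comp[of "[:0, N:]" Q] assms(2) by (simp add: degree_pcompose)
  ultimately show ?thesis using assms(1) by simp
qed

lemma U_eigenfunction_nth_power:
  assumes "U_op n F = fps_const c * F"
  shows "fps_nth F (n ^ j * k) = c ^ j * fps_nth F k"
proof (induction j)
  case (Suc j)
  have "fps_nth F (n * (n ^ j * k)) = fps_nth (U_op n F) (n ^ j * k)"
    by (simp add: U_op_def)
  also have "\<dots> = c * fps_nth F (n ^ j * k)" by (simp add: assms)
  finally show ?case using Suc by (simp add: mult.assoc)
qed simp

text \<open>
  The coefficients along \<open>n\<^sup>e\<^sup>t k\<close> form a geometric progression with ratio \<open>c\<^sup>e\<close> and are at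
  the same time eventually values of one polynomial, because \<open>n\<^sup>e\<close> is \<open>1\<close> modulo \<open>n\<^sup>e - 1\<close>.
\<close>

lemma eigenvalue_power:
  assumes n: "n > 1" and F: "F \<in> rat_series" and c: "c \<noteq> 0" and U: "U_op n F = fps_const c * F"
    and k: "k > 0" "fps_nth F k \<noteq> 0"
  obtains e d where "e > 0" "c ^ e = of_nat n ^ (d * e)"
proof -
  obtain e K p where e: "e > 0"
      and p: "F * fps_of_poly ((1 - monom 1 (n ^ e - 1)) ^ K) = fps_of_poly p"
    using eigenfunction_denominator[of n F c] n F c U by auto
  define M where "M = n ^ e"
  have M: "M > 1" using one_less_power[OF n e] by (simp add: M_def)
  obtain Q N0 where Q: "\<And>N. N \<ge> N0 \<Longrightarrow> [N = k] (mod (M - 1)) \<Longrightarrow> fps_nth F N = poly Q (of_nat N)"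
    using coeffs_eventually_poly_on_residue_class[of "n ^ e - 1" F K p k] p M
    unfolding M_def by auto
  have val: "poly Q (of_nat (M ^ t * k)) = (c ^ e) ^ t * fps_nth F k" if "t \<ge> N0" for t
  proof -
    \<comment> \<open>The bound \<open>N0\<close> on indices also serves as a bound on exponents, since \<open>t < M\<^sup>t\<close>.\<close>
    have "t < M ^ t" using M power_gt_expt by simp
    moreover have "M ^ t * 1 \<le> M ^ t * k" using k by (intro mult_left_mono) auto
    ultimately have "N0 \<le> M ^ t * k" using that by linarith
    moreover have "[M = 1] (mod (M - 1))"
      using M by (simp add: cong_altdef_nat)
    then have "[M ^ t * k = 1 ^ t * k] (mod (M - 1))"
      by (intro cong_mult cong_pow) auto
    ultimately have "poly Q (of_nat (M ^ t * k)) = fps_nth F (M ^ t * k)"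
      using Q by simp
    also have "\<dots> = (c ^ e) ^ t * fps_nth F k"
      using U_eigenfunction_nth_power[OF U, of "e * t" k] by (simp add: M_def flip: power_mult)
    finally show ?thesis .
  qed
  have "c ^ e = of_nat M ^ degree Q"
  proof (rule poly_dilation_eigenvalue)
    show "Q \<noteq> 0" using val[of N0] c k by auto
    have "inj (\<lambda>t. of_nat (M ^ t * k) :: complex)"
      using M k by (auto simp: inj_def simp del: of_nat_mult of_nat_power)
    then have "infinite ((\<lambda>t. of_nat (M ^ t * k) :: complex) ` {N0..})"
      using infinite_Ici finite_imageD inj_on_subset by blast
    moreover have "of_nat M * of_nat (M ^ t * k) = (of_nat (M ^ Suc t * k) :: complex)" for t
      by simp
    then have "(\<lambda>t. of_nat (M ^ t * k)) ` {N0..} \<subseteq> {x. poly Q (of_nat M * x) = c ^ e * poly Q x}"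
      using val by (auto simp del: of_nat_mult of_nat_power power_Suc) (simp only: power_Suc mult.assoc)
    ultimately show "infinite {x. poly Q (of_nat M * x) = c ^ e * poly Q x}"
      using finite_subset by blast
  qed (use M in auto)
  then show ?thesis
    using that[of e "degree Q"] e by (simp add: M_def mult.commute flip: power_mult)
qed

text \<open>
  This realises every \<open>e > 0\<close> as a multiplicative order of \<open>n\<close>, so that all roots of unity occur
  among the listed values.
\<close>

lemma ord_power_minus_one:
  fixes n :: nat
  assumes "n > 1" "e > 0"
  shows "ord (n ^ e - 1) n = e"
proof -
  have gt: "n ^ e > 1" using assms by (rule one_less_power)
  then have "[n ^ e = 1] (mod (n ^ e - 1))" by (simp add: cong_altdef_nat)
  then have dvd: "ord (n ^ e - 1) n dvd e" by (simp add: ord_divides')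
  define d where "d = ord (n ^ e - 1) n"
  have d: "d > 0" "d \<le> e"
    using dvd_pos_nat[OF \<open>e > 0\<close> dvd] dvd_imp_le[OF dvd \<open>e > 0\<close>] by (simp_all only: d_def)
  have "[n ^ d = 1] (mod (n ^ e - 1))" unfolding d_def by (rule ord)
  then have "n ^ e - 1 dvd n ^ d - 1"
    using assms by (simp add: cong_altdef_nat)
  moreover have "n ^ d > 1" using assms(1) d(1) by (rule one_less_power)
  ultimately have "n ^ e \<le> n ^ d" using gt dvd_imp_le[of "n ^ e - 1" "n ^ d - 1"] by linarith
  with assms have "e \<le> d" by (simp add: power_increasing_iff)
  with d show ?thesis by (simp add: d_def)
qed

section \<open>Eigenfunctions for the listed values\<close>

lemma rat_series_X_deriv:
  assumes "F \<in> rat_series"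
  shows "fps_X * fps_deriv F \<in> rat_series"
proof -
  obtain p q where q: "coeff q 0 \<noteq> 0" and F: "F * fps_of_poly q = fps_of_poly p"
    using assms by (rule rat_seriesE)
  have "fps_deriv F * fps_of_poly q + F * fps_of_poly (pderiv q) = fps_of_poly (pderiv p)"
    by (simp add: fps_of_poly_pderiv flip: F)
  then have "fps_deriv F * fps_of_poly q = fps_of_poly (pderiv p) - F * fps_of_poly (pderiv q)"
    by (simp add: algebra_simps)
  then have "fps_deriv F * fps_of_poly q * fps_of_poly q =
      (fps_of_poly (pderiv p) - F * fps_of_poly (pderiv q)) * fps_of_poly q"
    by simp
  also have "\<dots> = fps_of_poly (pderiv p * q - p * pderiv q)"
    by (simp add: fps_of_poly_mult fps_of_poly_diff algebra_simps flip: F)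
  finally have "fps_X * fps_deriv F * fps_of_poly (q * q) =
      fps_of_poly ([:0, 1:] * (pderiv p * q - p * pderiv q))"
    by (simp only: fps_of_poly_mult fps_of_poly_fps_X mult.assoc)
  with q show ?thesis
    by (intro rat_seriesI[of "q * q"]) (auto simp: coeff_mult)
qed

text \<open>
  A periodic sequence has a generating function with denominator \<open>1 - x\<^sup>L\<close>, and the operator
  \<open>x d/dx\<close> inserts a factor \<open>k\<close> into the coefficients.
\<close>

lemma rat_series_power_times_periodic:
  fixes \<psi> :: "nat \<Rightarrow> complex"
  assumes "L > 0" "\<And>k. \<psi> (k + L) = \<psi> k"
  shows "Abs_fps (\<lambda>k. of_nat k ^ i * \<psi> k) \<in> rat_series"
proof (induction i)
  case 0
  define F where "F = Abs_fps \<psi>"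
  have "fps_nth (F * (1 - fps_X ^ L)) k = 0" if "k > L" for k
    using assms(2)[of "k - L"] that
    by (simp add: F_def right_diff_distrib fps_X_power_mult_right_nth)
  then obtain t where "F * (1 - fps_X ^ L) = fps_of_poly t"
    by (rule fps_eventually_zero_is_poly)
  then have "F * fps_of_poly (1 - monom 1 L) = fps_of_poly t"
    by (simp add: fps_of_poly_diff fps_of_poly_monom')
  then have "F \<in> rat_series"
    using assms(1) by (intro rat_seriesI[of "1 - monom 1 L"]) auto
  then show ?case by (simp add: F_def)
next
  case (Suc i)
  have "Abs_fps (\<lambda>k. of_nat k ^ Suc i * \<psi> k) = fps_X * fps_deriv (Abs_fps (\<lambda>k. of_nat k ^ i * \<psi> k))"
    by (rule fps_ext) (simp add: mult.assoc)
  with rat_series_X_deriv[OF Suc] show ?case by simp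
qed

text \<open>
  The function is supported on the residue classes of the powers of \<open>n\<close>. Two exponents of the same
  class differ by a multiple of \<open>ord L n\<close>, so \<open>\<omega>\<^sup>j\<close> depends on the class of \<open>n\<^sup>j\<close> only.
\<close>

lemma periodic_dilation_eigenfunction:
  fixes \<omega> :: complex and L n :: nat
  assumes L: "L > 0" "coprime L n" and \<omega>: "\<omega> ^ ord L n = 1"
  obtains \<psi> where "\<And>k. \<psi> (k + L) = \<psi> k" "\<psi> 1 = 1" "\<And>k. \<psi> (n * k) = \<omega> * \<psi> k"
proof -
  define P where "P = (\<lambda>k j. [k = n ^ j] (mod L))"
  define \<psi> where "\<psi> = (\<lambda>k. if \<exists>j. P k j then \<omega> ^ (SOME j. P k j) else 0)"
  have pow: "\<omega> ^ j = \<omega> ^ (j mod ord L n)" for j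
  proof -
    have "\<omega> ^ j = \<omega> ^ (ord L n * (j div ord L n) + j mod ord L n)" by simp
    also have "\<dots> = \<omega> ^ (j mod ord L n)" using \<omega> by (simp only: power_add power_mult) simp
    finally show ?thesis .
  qed
  have \<psi>: "\<psi> k = \<omega> ^ j" if "P k j" for k j
  proof -
    have "P k (SOME j. P k j)" using that by (rule someI)
    with that have "[n ^ (SOME j. P k j) = n ^ j] (mod L)"
      unfolding P_def by (metis cong_sym cong_trans)
    then have "[(SOME j. P k j) = j] (mod ord L n)"
      using order_divides_expdiff[of L n] L by (simp add: coprime_commute)
    then have "\<omega> ^ (SOME j. P k j) = \<omega> ^ j"
      using pow[of "SOME j. P k j"] pow[of j] by (simp only: unique_euclidean_semiring_class.cong_def)
    with that show ?thesis by (auto simp: \<psi>_def)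
  qed
  show ?thesis
  proof
    show "\<psi> (k + L) = \<psi> k" for k
      by (simp add: \<psi>_def P_def unique_euclidean_semiring_class.cong_def)
    show "\<psi> 1 = 1" using \<psi>[of 1 0] by (simp add: P_def)
    show "\<psi> (n * k) = \<omega> * \<psi> k" for k
    proof (cases "\<exists>j. P k j")
      case True
      then obtain j where j: "P k j" by blast
      then have "P (n * k) (Suc j)" by (simp add: P_def cong_scalar_left)
      with j show ?thesis by (simp add: \<psi>)
    next
      case False
      obtain d where d: "ord L n = Suc d"
        using L(2) by (metis gr0_implies_Suc ord_gt_0_iff)
      \<comment> \<open>Adding a full period to the exponent makes it positive, so that \<open>n\<close> can be cancelled.\<close>
      have "\<not> P (n * k) j" for j
      proof
        assume "P (n * k) j"
        then have "[n * k = n ^ j * 1] (mod L)" by (simp add: P_def)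
        moreover have "[n ^ j * 1 = n ^ j * n ^ ord L n] (mod L)"
          using ord[of n L] by (intro cong_scalar_left) (rule cong_sym)
        moreover have "n ^ j * n ^ ord L n = n * n ^ (j + d)"
          using d by (simp add: power_add)
        ultimately have "[n * k = n * n ^ (j + d)] (mod L)"
          by (metis cong_trans)
        then have "P k (j + d)"
          using L(2) by (simp add: P_def cong_mult_lcancel_nat coprime_commute)
        with False show False by blast
      qed
      then have "\<not> (\<exists>j. P (n * k) j)" by blast
      then have "\<psi> (n * k) = 0" unfolding \<psi>_def by (rule if_not_P)
      moreover have "\<psi> k = 0" using False unfolding \<psi>_def by (rule if_not_P)
      ultimately show ?thesis by simp
    qed
  qed
qed

theorem corollary2:
  fixes n :: nat
  assumes "n > 0"
  shows "{c :: complex. c \<noteq> 0 \<and> U_eigenvalue n c} =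
         {exp (2 * of_real pi * \<i> * of_int m / of_nat (ord L n)) * of_nat n ^ (\<kappa> - 1)
            | (m :: int) (\<kappa> :: nat) (L :: nat). \<kappa> > 0 \<and> L > 0 \<and> gcd n L = 1}"
    (is "?E = ?S")
proof (intro Set.equalityI subsetI)
  fix c assume "c \<in> ?E"
  then obtain F where c: "c \<noteq> 0" and F: "F \<in> rat_series" "F \<noteq> 0" and U: "U_op n F = fps_const c * F"
    by (auto simp: U_eigenvalue_def)
  note ev = U_eigenfunction_nth_power[OF U, of 1, simplified]
  have one: "c \<in> ?S" if "c = 1"
    using that by (intro CollectI exI[of _ "0::int"] exI[of _ "1::nat"]) auto
  obtain k where k: "fps_nth F k \<noteq> 0"
    using F(2) by (auto simp: fps_eq_iff)
  show "c \<in> ?S"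
  proof (cases "n > 1 \<and> k > 0")
    case False
    with assms have "n * k = k" by (cases "n = 1") auto
    with ev[of k] k have "c = 1" by simp
    then show ?thesis by (rule one)
  next
    case True
    then obtain e d where e: "e > 0" "c ^ e = of_nat n ^ (d * e)"
      using eigenvalue_power[of n F c k] F c U k by blast
    define z where "z = c / of_nat n ^ d"
    have "z ^ e = 1"
      using e assms by (simp add: z_def power_divide flip: power_mult)
    then obtain j where j: "z = exp (2 * of_real pi * \<i> * of_nat j / of_nat e)"
      using complex_roots_unity[of e] e(1) by auto
    have ordL: "ord (n ^ e - 1) n = e"
      using True e(1) by (intro ord_power_minus_one) auto
    have "coprime (n ^ e - 1) n"
      using ord_eq_0[of "n ^ e - 1" n] ordL e(1) by auto
    then have "gcd n (n ^ e - 1) = 1"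
      by (simp add: coprime_iff_gcd_eq_1 gcd.commute)
    moreover have "n ^ e - 1 > 0" using True e(1) one_less_power[of n e] by simp
    moreover have "c = exp (2 * of_real pi * \<i> * of_int (int j) / of_nat (ord (n ^ e - 1) n)) *
        of_nat n ^ (Suc d - 1)"
      unfolding ordL using j assms by (simp add: z_def field_simps)
    ultimately show ?thesis
      by (intro CollectI exI[of _ "int j"] exI[of _ "Suc d"] exI[of _ "n ^ e - 1"]) simp_all
  qed
next
  fix c assume "c \<in> ?S"
  then obtain m :: int and \<kappa> L :: nat where L: "L > 0" "gcd n L = 1"
    and c: "c = exp (2 * of_real pi * \<i> * of_int m / of_nat (ord L n)) * of_nat n ^ (\<kappa> - 1)"
    by (elim CollectE exE conjE) (rule that)
  define \<omega> where "\<omega> = exp (2 * of_real pi * \<i> * of_int m / of_nat (ord L n))"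
  have cop: "coprime L n"
    using L(2) by (simp add: coprime_iff_gcd_eq_1 gcd.commute)
  then have "ord L n > 0" by simp
  then have "\<omega> ^ ord L n = exp (2 * of_real pi * \<i> * of_int m)"
    unfolding \<omega>_def by (subst exp_of_nat_mult[symmetric]) simp
  also have "\<dots> = 1"
    using exp_integer_2pi[of "of_int m"] by (simp add: mult_ac)
  finally obtain \<psi> where per: "\<And>k. \<psi> (k + L) = \<psi> k" and one: "\<psi> 1 = 1"
    and dil: "\<And>k. \<psi> (n * k) = \<omega> * \<psi> k"
    using periodic_dilation_eigenfunction[OF L(1) cop] by metis
  define F where "F = Abs_fps (\<lambda>k. of_nat k ^ (\<kappa> - 1) * \<psi> k)"
  have "F \<in> rat_series"
    unfolding F_def using L(1) per by (rule rat_series_power_times_periodic)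
  moreover have "fps_nth F 1 = 1"
    using one by (simp add: F_def)
  then have "F \<noteq> 0" by auto
  moreover have "U_op n F = fps_const c * F"
    by (rule fps_ext) (simp add: U_op_def F_def dil c \<omega>_def power_mult_distrib)
  moreover have "c \<noteq> 0" using assms by (simp add: c)
  ultimately show "c \<in> ?E" by (auto simp: U_eigenvalue_def)
qed

end
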